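(* Let $\mathbb{S}$ be a metric space, let $\{P_n\}_{n=1,2,\ldots}$ be a sequence of probability measures from $\mathbb{P}(\mathbb{S})$ and let $P\in\mathbb{P}(\mathbb{S})$. If the topology on $\mathbb{S}$ has a countable base $\tau_b$, then $P_n$ converges setwise to $P$ if and only if the following two conditions hold: (i) $\liminf_{n\to\infty}P_n(\mathcal{O}^* )\ge P(\mathcal{O}^* )$ for each finite union $\mathcal{O}^*=\bigcup_{i=1}^k\mathcal{O}_i$, where $\mathcal{O}_i\in\tau_b$, $k=1,2,\ldots$; (ii) for each closed subset $B\subseteq\mathbb{S}$ there is a countable sequence of measurable subsets $B_1,B_2,\ldots$ of $B$ such that $B=\bigcup_{j=1}^\infty B_j$ and $\liminf_{n\to\infty}P_n(\bigcup_{j=1}^kB_j)\ge P(\bigcup_{j=1}^kB_j)$ for all $k=1,2,\ldots$.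
   Context: $\mathbb{P}(\mathbb{S})$ is the set of probability measures on $(\mathbb{S},\mathcal{B}(\mathbb{S}))$, where $\mathcal{B}(\mathbb{S})$ is the Borel $\sigma$-field of $\mathbb{S}$; measurable means Borel. $P_n$ converges setwise to $P$ if $\int_{\mathbb{S}}f\,dP_n\to\int_{\mathbb{S}}f\,dP$ for every bounded Borel-measurable $f:\mathbb{S}\to\mathbb{R}$, equivalently $P_n(E)\to P(E)$ for each $E\in\mathcal{B}(\mathbb{S})$. *)

theory Defs
  imports "HOL-Probability.Probability"
begin

text \<open>Since the measures of interest are Borel measures, \<open>f\<close> ranges over the bounded real-valued
  functions measurable with respect to the Borel sigma-algebra of the underlying space.\<close>

definition setwise_converges ::
    "(nat \<Rightarrow> 'a::topological_space measure) \<Rightarrow> 'a measure \<Rightarrow> bool" where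
  "setwise_converges P Q \<longleftrightarrow>
     (\<forall>f :: 'a \<Rightarrow> real. f \<in> borel_measurable borel \<longrightarrow> bounded (range f) \<longrightarrow>
        (\<lambda>n. integral\<^sup>L (P n) f) \<longlonglongrightarrow> integral\<^sup>L Q f)"

end

theory Submission
  imports Defs
begin

text \<open>
  On a metric space the finite Borel measure \<open>Q\<close> approximates each Borel set \<open>E\<close> from inside by a
  closed set \<open>F\<close> up to any \<open>e > 0\<close> (\<open>borel_closed_inner_approx\<close>). Hence a lower bound
  \<open>liminf P\<^sub>n(F) \<ge> Q(F)\<close> known for closed \<open>F\<close> is inherited by \<open>E\<close>:
  \<open>liminf P\<^sub>n(E) \<ge> liminf P\<^sub>n(F) \<ge> Q(F) \<ge> Q(E) - e\<close>. This works because \<open>F\<close> is chosen from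
  \<open>Q\<close>, \<open>E\<close> and \<open>e\<close> alone, so it is the same for all \<open>n\<close>. Applied to \<open>E\<close> and to its complement,
  and because all measures have total mass one, the lower bound upgrades to
  \<open>P\<^sub>n(E) \<longlonglongrightarrow> Q(E)\<close> (\<open>measure_tendsto_of_lower_bounds\<close>).

  The lower bound for closed sets comes from condition (ii) by the same idea of approximating from
  inside: the finite unions of the pieces \<open>C j\<close> increase to \<open>B\<close>, so the \<open>Q\<close>-mass that they
  leave out tends to zero. Both exhaustion arguments are instances of
  \<open>asymptotic_lower_bound_approx\<close>. The passage from sets to bounded functions is uniform
  approximation by functions with finitely many values.

  Conversely, testing setwise convergence on indicators gives convergence on each Borel set,
  which yields (i) at once and (ii) with the constant sequence \<open>C j = B\<close>.
\<close>

section \<open>Asymptotic lower bounds on sets\<close>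

text \<open>Total masses are finite, so the bound on the limes inferior can be
  handled with real numbers, where differences of measures make sense.\<close>

lemma liminf_emeasure_ge_iff:
  assumes "\<And>n. prob_space (P n)" and "prob_space Q"
  shows "emeasure Q E \<le> liminf (\<lambda>n. emeasure (P n) E) \<longleftrightarrow>
    (\<forall>e>0. \<forall>\<^sub>F n in sequentially. measure Q E - e < measure (P n) E)"
    (is "?L \<longleftrightarrow> ?R")
proof -
  interpret Q: prob_space Q by fact
  interpret P: prob_space "P n" for n by fact
  have L: "?L \<longleftrightarrow> (\<forall>y<ennreal (measure Q E). \<forall>\<^sub>F n in sequentially. y < ennreal (measure (P n) E))"
    by (simp add: le_Liminf_iff Q.emeasure_eq_measure P.emeasure_eq_measure)
  show ?thesis
  proof
    assume ?L
    show ?R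
    proof (intro allI impI)
      fix e :: real assume "e > 0"
      show "\<forall>\<^sub>F n in sequentially. measure Q E - e < measure (P n) E"
      proof (cases "measure Q E - e < 0")
        case True
        then have "measure Q E - e < measure (P n) E" for n
          using measure_nonneg[of "P n" E] by linarith
        then show ?thesis by simp
      next
        case False
        then have "ennreal (measure Q E - e) < ennreal (measure Q E)"
          using \<open>e > 0\<close> by (simp add: ennreal_less_iff)
        then have "\<forall>\<^sub>F n in sequentially. ennreal (measure Q E - e) < ennreal (measure (P n) E)"
          using \<open>?L\<close> L by blast
        then show ?thesis
          using False by (simp add: ennreal_less_iff)
      qed
    qed
  next
    assume R: ?R
    show ?L
      unfolding L
    proof (intro allI impI)
      fix y assume y: "y < ennreal (measure Q E)"
      then obtain r where r: "y = ennreal r" "0 \<le> r"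
        by (cases y) auto
      then have "measure Q E - r > 0"
        using y by (simp add: ennreal_less_iff)
      then have "\<forall>\<^sub>F n in sequentially. measure Q E - (measure Q E - r) < measure (P n) E"
        using R by blast
      then show "\<forall>\<^sub>F n in sequentially. y < ennreal (measure (P n) E)"
        using r by (simp add: ennreal_less_iff)
    qed
  qed
qed

text \<open>The eventual bound for \<open>F\<close> passes to every superset \<open>E\<close>, losing only the \<open>Q\<close>-mass between
  the two. The approximating set may depend on the error but not on \<open>n\<close>.\<close>

lemma asymptotic_lower_bound_approx:
  assumes "\<And>n. prob_space (P n)" and "\<And>n. sets (P n) = sets borel" and "prob_space Q"
    and E: "E \<in> sets borel"
    and approx: "\<And>e. e > 0 \<Longrightarrow> \<exists>F. F \<subseteq> E \<and> measure Q E - e < measure Q F \<and>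
      emeasure Q F \<le> liminf (\<lambda>n. emeasure (P n) F)"
  shows "emeasure Q E \<le> liminf (\<lambda>n. emeasure (P n) E)"
  unfolding liminf_emeasure_ge_iff[OF assms(1,3)]
proof (intro allI impI)
  interpret P: prob_space "P n" for n by fact
  fix e :: real assume "e > 0"
  then obtain F where F: "F \<subseteq> E" "measure Q E - e/2 < measure Q F"
    "emeasure Q F \<le> liminf (\<lambda>n. emeasure (P n) F)"
    using approx[of "e/2"] by auto
  have "\<forall>\<^sub>F n in sequentially. measure Q F - e/2 < measure (P n) F"
    using F(3) \<open>e > 0\<close> unfolding liminf_emeasure_ge_iff[OF assms(1,3)] by simp
  then show "\<forall>\<^sub>F n in sequentially. measure Q E - e < measure (P n) E"
  proof eventually_elim
    case (elim n)
    have "measure (P n) F \<le> measure (P n) E"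
      using F(1) E by (intro P.finite_measure_mono) (auto simp: assms(2))
    then show ?case
      using elim F(2) by linarith
  qed
qed

lemma liminf_emeasure_UN_ge:
  fixes C :: "nat \<Rightarrow> 'a::topological_space set"
  assumes P: "\<And>n. prob_space (P n)" "\<And>n. sets (P n) = sets borel"
    and Q: "prob_space Q" "sets Q = sets borel"
    and C: "\<And>j. C j \<in> sets borel"
    and bound: "\<And>k. k \<ge> 1 \<Longrightarrow>
      emeasure Q (\<Union>j<k. C j) \<le> liminf (\<lambda>n. emeasure (P n) (\<Union>j<k. C j))"
  shows "emeasure Q (\<Union>j. C j) \<le> liminf (\<lambda>n. emeasure (P n) (\<Union>j. C j))"
proof (rule asymptotic_lower_bound_approx[OF P Q(1)])
  show "(\<Union>j. C j) \<in> sets borel" using C by auto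
  interpret Q: prob_space Q by fact
  fix e :: real assume "e > 0"
  have "(\<lambda>k. measure Q (\<Union>j<Suc k. C j)) \<longlonglongrightarrow> measure Q (\<Union>k. \<Union>j<Suc k. C j)"
    using C by (intro Q.finite_Lim_measure_incseq)
      (auto simp: Q(2) incseq_def intro: less_le_trans)
  moreover have "(\<Union>k. \<Union>j<Suc k. C j) = (\<Union>j. C j)"
    by (auto intro: lessI)
  ultimately have "\<forall>\<^sub>F k in sequentially. measure Q (\<Union>j. C j) - e < measure Q (\<Union>j<Suc k. C j)"
    using \<open>e > 0\<close> by (intro order_tendstoD) auto
  then obtain k where "measure Q (\<Union>j. C j) - e < measure Q (\<Union>j<Suc k. C j)"
    by (auto simp: eventually_sequentially)
  then show "\<exists>F. F \<subseteq> (\<Union>j. C j) \<and> measure Q (\<Union>j. C j) - e < measure Q F \<and>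
      emeasure Q F \<le> liminf (\<lambda>n. emeasure (P n) F)"
    using bound[of "Suc k"] by (intro exI[of _ "\<Union>j<Suc k. C j"]) auto
qed

section \<open>Closed regularity of finite Borel measures on metric spaces\<close>

text \<open>Closed sets can be approximated by open ones because a closed set is the decreasing
  intersection of its open metric neighbourhoods.\<close>

lemma closed_outer_approx:
  fixes M :: "'a::metric_space measure"
  assumes "finite_measure M" and sets_M: "sets M = sets borel"
    and "closed F" and "(e::real) > 0"
  shows "\<exists>U. open U \<and> F \<subseteq> U \<and> measure M (U - F) < e"
proof (cases "F = {}")
  case True
  then show ?thesis using \<open>e > 0\<close> by (intro exI[of _ "{}"]) auto
next
  case False
  interpret finite_measure M by fact
  define U where "U n = {x. infdist x F < 1 / real (Suc n)}" for n
  have open_U: "open (U n)" for n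
    unfolding U_def by (intro open_Collect_less continuous_intros)
  have sub: "F \<subseteq> U n" for n
    by (auto simp: U_def)
  have "(\<Inter>n. U n - F) = {}"
  proof (rule ccontr)
    assume "(\<Inter>n. U n - F) \<noteq> {}"
    then obtain x where x: "\<And>n. infdist x F < 1 / real (Suc n)" "x \<notin> F"
      by (auto simp: U_def)
    have "infdist x F > 0"
      using infdist_pos_not_in_closed[OF \<open>closed F\<close> False x(2)] .
    then obtain n where "1 / real (Suc n) < infdist x F"
      by (rule nat_approx_posE)
    then show False using x(1)[of n] by linarith
  qed
  moreover have "(\<lambda>n. measure M (U n - F)) \<longlonglongrightarrow> measure M (\<Inter>n. U n - F)"
  proof (rule finite_Lim_measure_decseq)
    show "range (\<lambda>n. U n - F) \<subseteq> sets M"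
      using open_U \<open>closed F\<close> by (auto simp: sets_M)
    have "U n \<subseteq> U m" if "m \<le> n" for m n
    proof -
      have "1 / real (Suc n) \<le> 1 / real (Suc m)"
        using that by (intro divide_left_mono) auto
      then show ?thesis by (auto simp: U_def)
    qed
    then show "decseq (\<lambda>n. U n - F)"
      by (fastforce simp: decseq_def)
  qed
  ultimately have "(\<lambda>n. measure M (U n - F)) \<longlonglongrightarrow> 0"
    by (simp only: measure_empty)
  from order_tendstoD(2)[OF this \<open>e > 0\<close>] obtain n where "measure M (U n - F) < e"
    by (auto simp: eventually_sequentially)
  then show ?thesis using open_U sub by blast
qed

text \<open>The sets with a closed inner and an open outer approximation form a sigma-algebra. Demanding
  both approximations at once is what makes the family stable under complements.\<close>

lemma borel_sandwich_closed_open: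
  fixes M :: "'a::metric_space measure"
  assumes M: "finite_measure M" and sets_M: "sets M = sets borel"
    and E: "E \<in> sets borel" and "(e::real) > 0"
  shows "\<exists>F U. closed F \<and> open U \<and> F \<subseteq> E \<and> E \<subseteq> U \<and> measure M (U - F) < e"
proof -
  interpret finite_measure M by fact
  have "E \<in> sigma_sets UNIV (Collect closed)"
    using E by (simp add: borel_eq_closed)
  then show ?thesis using \<open>e > 0\<close>
  proof (induction arbitrary: e)
    case (Basic F)
    then show ?case
      using closed_outer_approx[OF M sets_M, of F e] by auto
  next
    case Empty
    then show ?case by (intro exI[of _ "{}"]) auto
  next
    case (Compl E)
    obtain F U where FU: "closed F" "open U" "F \<subseteq> E" "E \<subseteq> U" "measure M (U - F) < e"
      using Compl.IH[OF Compl.prems] by blast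
    have "- F - - U = U - F" by auto
    then show ?case
      using FU by (intro exI[of _ "- U"] exI[of _ "- F"]) auto
  next
    case (Union E)
    have "\<exists>F U. closed F \<and> open U \<and> F \<subseteq> E i \<and> E i \<subseteq> U \<and>
        measure M (U - F) < e/2 * (1/2) ^ Suc i" for i
      using Union.prems by (intro Union.IH) simp
    then obtain F U where closed_F: "\<And>i. closed (F i)" and open_U: "\<And>i. open (U i)"
      and FE: "\<And>i. F i \<subseteq> E i" and EU: "\<And>i. E i \<subseteq> U i"
      and small: "\<And>i. measure M (U i - F i) < e/2 * (1/2) ^ Suc i"
      by metis
    let ?U = "\<Union>i. U i" and ?F = "\<Union>i. F i"
    have sets_diff: "U i - F i \<in> sets M" for i
      using closed_F open_U by (auto simp: sets_M)
    have geo: "(\<lambda>i. e/2 * (1/2) ^ Suc i) sums (e/2)"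
      using sums_mult[OF power_half_series, of "e/2"] by simp
    have summ: "summable (\<lambda>i. measure M (U i - F i))"
      using small by (intro summable_comparison_test'[OF sums_summable[OF geo]])
        (auto intro: less_imp_le)
    have "measure M (?U - ?F) \<le> measure M (\<Union>i. U i - F i)"
      using sets_diff by (intro finite_measure_mono) auto
    also have "\<dots> \<le> (\<Sum>i. measure M (U i - F i))"
      using sets_diff summ by (intro finite_measure_subadditive_countably) auto
    also have "\<dots> \<le> e/2"
      using suminf_le[OF less_imp_le[OF small] summ sums_summable[OF geo]] sums_unique[OF geo]
      by simp
    finally have half: "measure M (?U - ?F) < e"
      using Union.prems by simp
    \<comment> \<open>A countable union of closed sets need not be closed, so it is cut off at a finite stage.\<close>
    have "(\<lambda>k. measure M (?U - (\<Union>i<k. F i))) \<longlonglongrightarrow> measure M (\<Inter>k. ?U - (\<Union>i<k. F i))"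
    proof (rule finite_Lim_measure_decseq)
      show "range (\<lambda>k. ?U - (\<Union>i<k. F i)) \<subseteq> sets M"
        using closed_F open_U by (auto simp: sets_M)
      show "decseq (\<lambda>k. ?U - (\<Union>i<k. F i))"
        by (auto simp: decseq_def intro: less_le_trans)
    qed
    moreover have "(\<Inter>k. ?U - (\<Union>i<k. F i)) = ?U - ?F"
      by auto
    ultimately have "\<forall>\<^sub>F k in sequentially. measure M (?U - (\<Union>i<k. F i)) < e"
      using half by (intro order_tendstoD) auto
    then obtain k where "measure M (?U - (\<Union>i<k. F i)) < e"
      by (auto simp: eventually_sequentially)
    moreover have "closed (\<Union>i<k. F i)" "open ?U"
      using closed_F open_U by auto
    moreover have "(\<Union>i<k. F i) \<subseteq> (\<Union>i. E i)" "(\<Union>i. E i) \<subseteq> ?U"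
      using FE EU by blast+
    ultimately show ?case by blast
  qed
qed

lemma borel_closed_inner_approx:
  fixes M :: "'a::metric_space measure"
  assumes M: "finite_measure M" "sets M = sets borel"
    and E: "E \<in> sets borel" and e: "(e::real) > 0"
  shows "\<exists>F. closed F \<and> F \<subseteq> E \<and> measure M E - e < measure M F"
proof -
  interpret finite_measure M by fact
  obtain F U where FU: "closed F" "open U" "F \<subseteq> E" "E \<subseteq> U" "measure M (U - F) < e"
    using borel_sandwich_closed_open[OF M E e] by blast
  have "measure M E - measure M F = measure M (E - F)"
    using FU E by (intro finite_measure_Diff[symmetric]) (auto simp: M(2))
  also have "\<dots> \<le> measure M (U - F)"
    using FU E by (intro finite_measure_mono) (auto simp: M(2))
  finally show ?thesis using FU by (intro exI[of _ F]) auto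
qed

section \<open>Setwise convergence and convergence on Borel sets\<close>

text \<open>The lower bound for the complement of \<open>E\<close> is an upper bound for \<open>E\<close>.\<close>

lemma measure_tendsto_of_lower_bounds:
  fixes P :: "nat \<Rightarrow> 'a::topological_space measure"
  assumes P: "\<And>n. prob_space (P n)" "\<And>n. sets (P n) = sets borel"
    and Q: "prob_space Q" "sets Q = sets borel"
    and bound: "\<And>E. E \<in> sets borel \<Longrightarrow> emeasure Q E \<le> liminf (\<lambda>n. emeasure (P n) E)"
    and E: "E \<in> sets borel"
  shows "(\<lambda>n. measure (P n) E) \<longlonglongrightarrow> measure Q E"
proof (rule order_tendstoI)
  interpret Q: prob_space Q by fact
  interpret P: prob_space "P n" for n by fact
  have lower: "\<forall>\<^sub>F n in sequentially. measure Q A - e < measure (P n) A"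
    if "A \<in> sets borel" "e > 0" for A e
    using bound[OF that(1)] that(2) by (simp add: liminf_emeasure_ge_iff[of P Q, OF P(1) Q(1)])
  have compl: "measure Q (- E) = 1 - measure Q E" "measure (P n) (- E) = 1 - measure (P n) E" for n
    using Q.prob_compl[of E] P.prob_compl[of E n] E
    by (simp_all add: P(2) Q(2) sets_eq_imp_space_eq[OF P(2)] sets_eq_imp_space_eq[OF Q(2)]
        Compl_eq_Diff_UNIV)
  fix a
  show "\<forall>\<^sub>F n in sequentially. a < measure (P n) E" if "a < measure Q E"
    using lower[OF E, of "measure Q E - a"] that by simp
  show "\<forall>\<^sub>F n in sequentially. measure (P n) E < a" if "measure Q E < a"
    using lower[of "- E" "a - measure Q E"] that E by (simp add: compl borel_comp)
qed

lemma measure_tendsto_of_setwise_converges: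
  assumes "setwise_converges P Q"
    and P: "\<And>n. sets (P n) = sets borel" and Q: "sets Q = sets borel"
    and E: "E \<in> sets borel"
  shows "(\<lambda>n. measure (P n) E) \<longlonglongrightarrow> measure Q E"
proof -
  have "(\<lambda>n. integral\<^sup>L (P n) (indicator E :: _ \<Rightarrow> real)) \<longlonglongrightarrow> integral\<^sup>L Q (indicator E)"
  proof (rule assms(1)[unfolded setwise_converges_def, rule_format])
    show "(indicator E :: _ \<Rightarrow> real) \<in> borel_measurable borel"
      using E by simp
    show "bounded (range (indicator E :: _ \<Rightarrow> real))"
      by (auto simp: bounded_iff indicator_def intro!: exI[of _ 1])
  qed
  then show ?thesis
    by (simp add: sets_eq_imp_space_eq[OF P] sets_eq_imp_space_eq[OF Q])
qed

text \<open>The function \<open>e * \<lfloor>f / e\<rfloor>\<close> is within \<open>e\<close> of \<open>f\<close> and, as \<open>f\<close> is bounded, has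
  finitely many values. Its integral is a finite combination of measures of its level sets, with
  coefficients that do not involve the measure.\<close>

lemma bounded_integral_finite_approx:
  fixes f :: "'a::topological_space \<Rightarrow> real"
  assumes f: "f \<in> borel_measurable borel" and "bounded (range f)" and "e > 0"
  obtains K :: "int set" and c :: "int \<Rightarrow> real" and L :: "int \<Rightarrow> 'a set"
  where "\<And>k. L k \<in> sets borel"
    and "\<And>M. prob_space M \<Longrightarrow> sets M = sets borel \<Longrightarrow>
      \<bar>integral\<^sup>L M f - (\<Sum>k\<in>K. c k * measure M (L k))\<bar> \<le> e"
proof -
  obtain B where B: "\<And>x. \<bar>f x\<bar> \<le> B"
    using \<open>bounded (range f)\<close> by (auto simp: bounded_iff)
  define K where "K = {\<lfloor>- B / e\<rfloor>..\<lfloor>B / e\<rfloor>}"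
  define L where "L k = {x. \<lfloor>f x / e\<rfloor> = k}" for k
  define g where "g x = (\<Sum>k\<in>K. e * of_int k * indicator (L k) x)" for x
  have L: "L k \<in> sets borel" for k
    unfolding L_def using f by measurable
  have mem_K: "\<lfloor>f x / e\<rfloor> \<in> K" for x
  proof -
    have "- B / e \<le> f x / e" "f x / e \<le> B / e"
      using B[of x] \<open>e > 0\<close> by (auto simp only: abs_le_iff intro!: divide_right_mono)
    then show ?thesis
      unfolding K_def by (simp only: atLeastAtMost_iff floor_mono)
  qed
  have g_eq: "g x = e * of_int \<lfloor>f x / e\<rfloor>" for x
  proof -
    have "g x = (\<Sum>k\<in>K. if \<lfloor>f x / e\<rfloor> = k then e * of_int k else 0)"
      unfolding g_def by (intro sum.cong) (auto simp: L_def indicator_def)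
    also have "\<dots> = e * of_int \<lfloor>f x / e\<rfloor>"
      using mem_K[of x] by (simp add: K_def)
    finally show ?thesis .
  qed
  have close: "\<bar>f x - g x\<bar> \<le> e" for x
  proof -
    have "of_int \<lfloor>f x / e\<rfloor> \<le> f x / e" "f x / e < of_int \<lfloor>f x / e\<rfloor> + 1"
      by linarith+
    then have "g x \<le> f x" "f x < g x + e"
      using \<open>e > 0\<close>
      by (simp_all only: g_eq pos_le_divide_eq pos_divide_less_eq) (simp_all add: algebra_simps)
    then show ?thesis by simp
  qed
  have "\<bar>integral\<^sup>L M f - (\<Sum>k\<in>K. e * of_int k * measure M (L k))\<bar> \<le> e"
    if "prob_space M" and sets_M: "sets M = sets borel" for M :: "'a measure"
  proof -
    interpret prob_space M by fact
    have L_M: "L k \<in> sets M" for k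
      using L by (simp add: sets_M)
    have int_ind: "integrable M (\<lambda>x. e * of_int k * indicator (L k) x)" for k
      using L_M[of k] by (intro integrable_mult_right integrable_real_indicator)
        (auto simp: less_top[symmetric])
    have int_f: "integrable M f"
      using f B by (intro integrable_const_bound[where B=B])
        (auto simp: measurable_cong_sets[OF sets_M refl])
    have int_g: "integrable M g"
      unfolding g_def by (intro Bochner_Integration.integrable_sum int_ind)
    have "integral\<^sup>L M g = (\<Sum>k\<in>K. e * of_int k * measure M (L k))"
      unfolding g_def using int_ind
      by (subst Bochner_Integration.integral_sum)
        (auto simp: sets_eq_imp_space_eq[OF sets_M] simp del: mult.assoc)
    moreover have "\<bar>integral\<^sup>L M f - integral\<^sup>L M g\<bar> \<le> e"
    proof -
      have "\<bar>integral\<^sup>L M f - integral\<^sup>L M g\<bar> = \<bar>\<integral>x. f x - g x \<partial>M\<bar>"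
        using int_f int_g by simp
      also have "\<dots> \<le> (\<integral>x. \<bar>f x - g x\<bar> \<partial>M)"
        by (rule integral_abs_bound)
      also have "\<dots> \<le> (\<integral>x. e \<partial>M)"
        using int_f int_g close by (intro integral_mono) auto
      also have "\<dots> = e"
        by (simp add: prob_space)
      finally show ?thesis .
    qed
    ultimately show ?thesis
      by simp
  qed
  then show thesis
    by (rule that[OF L])
qed

lemma setwise_converges_of_measure_tendsto:
  fixes P :: "nat \<Rightarrow> 'a::topological_space measure"
  assumes P: "\<And>n. prob_space (P n)" "\<And>n. sets (P n) = sets borel"
    and Q: "prob_space Q" "sets Q = sets borel"
    and lim: "\<And>E. E \<in> sets borel \<Longrightarrow> (\<lambda>n. measure (P n) E) \<longlonglongrightarrow> measure Q E"
  shows "setwise_converges P Q"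
  unfolding setwise_converges_def
proof (intro allI impI)
  fix f :: "'a \<Rightarrow> real"
  assume f: "f \<in> borel_measurable borel" "bounded (range f)"
  show "(\<lambda>n. integral\<^sup>L (P n) f) \<longlonglongrightarrow> integral\<^sup>L Q f"
  proof (rule LIMSEQ_I)
    fix r :: real assume "r > 0"
    then have "r/4 > 0" by simp
    obtain K :: "int set" and c :: "int \<Rightarrow> real" and L :: "int \<Rightarrow> 'a set"
      where L: "\<And>k. L k \<in> sets borel"
        and approx: "\<And>M. prob_space M \<Longrightarrow> sets M = sets borel \<Longrightarrow>
          \<bar>integral\<^sup>L M f - (\<Sum>k\<in>K. c k * measure M (L k))\<bar> \<le> r/4"
      using bounded_integral_finite_approx[OF f \<open>r/4 > 0\<close>] by metis
    let ?s = "\<lambda>M. \<Sum>k\<in>K. c k * measure M (L k)"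
    have "(\<lambda>n. ?s (P n)) \<longlonglongrightarrow> ?s Q"
      using lim L by (intro tendsto_intros) auto
    from LIMSEQ_D[OF this, of "r/4"] \<open>r > 0\<close>
    obtain N where N: "\<And>n. n \<ge> N \<Longrightarrow> \<bar>?s (P n) - ?s Q\<bar> < r/4"
      by auto
    have "\<bar>integral\<^sup>L (P n) f - integral\<^sup>L Q f\<bar> < r" if "n \<ge> N" for n
      using N[OF that] approx[OF P, of n] approx[OF Q] \<open>r > 0\<close> by linarith
    then show "\<exists>N. \<forall>n\<ge>N. norm (integral\<^sup>L (P n) f - integral\<^sup>L Q f) < r"
      by auto
  qed
qed

section \<open>The criterion for setwise convergence\<close>

theorem theorem3p5:
  fixes P :: "nat \<Rightarrow> 'a::metric_space measure"
    and Q :: "'a measure"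
    and \<tau> :: "'a set set"
  assumes "\<And>n. prob_space (P n)" and "\<And>n. sets (P n) = sets borel"
    and "prob_space Q" and "sets Q = sets borel"
    and "countable \<tau>" and "topological_basis \<tau>"
  shows "setwise_converges P Q \<longleftrightarrow>
    (\<forall>k\<ge>1. \<forall>U :: nat \<Rightarrow> 'a set. (\<forall>i<k. U i \<in> \<tau>) \<longrightarrow>
       liminf (\<lambda>n. emeasure (P n) (\<Union>i<k. U i)) \<ge> emeasure Q (\<Union>i<k. U i)) \<and>
    (\<forall>B. closed B \<longrightarrow>
       (\<exists>C :: nat \<Rightarrow> 'a set.
          (\<forall>j. C j \<in> sets borel \<and> C j \<subseteq> B) \<and> B = (\<Union>j. C j) \<and>
          (\<forall>k\<ge>1. liminf (\<lambda>n. emeasure (P n) (\<Union>j<k. C j)) \<ge> emeasure Q (\<Union>j<k. C j))))"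
    (is "_ \<longleftrightarrow> ?i \<and> ?ii")
proof
  note P = assms(1,2) and Q = assms(3,4)
  interpret Q: prob_space Q by fact
  interpret P: prob_space "P n" for n by fact
  assume conv: "setwise_converges P Q"
  have bound: "emeasure Q E \<le> liminf (\<lambda>n. emeasure (P n) E)" if "E \<in> sets borel" for E
  proof -
    have "(\<lambda>n. emeasure (P n) E) \<longlonglongrightarrow> emeasure Q E"
      using measure_tendsto_of_setwise_converges[OF conv P(2) Q(2) that]
      by (auto simp: P.emeasure_eq_measure Q.emeasure_eq_measure)
    then have "liminf (\<lambda>n. emeasure (P n) E) = emeasure Q E"
      by (intro lim_imp_Liminf) auto
    then show ?thesis by simp
  qed
  show "?i \<and> ?ii"
  proof (intro conjI allI impI)
    fix k :: nat and U :: "nat \<Rightarrow> 'a set"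
    assume "\<forall>i<k. U i \<in> \<tau>"
    then have "open (\<Union>i<k. U i)"
      using topological_basis_open[OF assms(6)] by auto
    then show "emeasure Q (\<Union>i<k. U i) \<le> liminf (\<lambda>n. emeasure (P n) (\<Union>i<k. U i))"
      by (intro bound) auto
  next
    fix B :: "'a set" assume "closed B"
    then show "\<exists>C :: nat \<Rightarrow> 'a set. (\<forall>j. C j \<in> sets borel \<and> C j \<subseteq> B) \<and> B = (\<Union>j. C j) \<and>
        (\<forall>k\<ge>1. emeasure Q (\<Union>j<k. C j) \<le> liminf (\<lambda>n. emeasure (P n) (\<Union>j<k. C j)))"
      by (intro exI[of _ "\<lambda>_. B"] conjI allI impI bound) auto
  qed
next
  note P = assms(1,2) and Q = assms(3,4)
  interpret Q: prob_space Q by fact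
  assume "?i \<and> ?ii"
  then have ii: ?ii ..
  have closed_bound: "emeasure Q B \<le> liminf (\<lambda>n. emeasure (P n) B)" if B: "closed B" for B
  proof -
    obtain C :: "nat \<Rightarrow> 'a set" where C: "\<And>j. C j \<in> sets borel" "B = (\<Union>j. C j)"
      "\<And>k. k \<ge> 1 \<Longrightarrow> emeasure Q (\<Union>j<k. C j) \<le> liminf (\<lambda>n. emeasure (P n) (\<Union>j<k. C j))"
      using ii B by meson
    show ?thesis
      unfolding C(2) by (rule liminf_emeasure_UN_ge[OF P Q C(1,3)])
  qed
  have "emeasure Q E \<le> liminf (\<lambda>n. emeasure (P n) E)" if E: "E \<in> sets borel" for E
  proof (rule asymptotic_lower_bound_approx[OF P Q(1) E])
    fix e :: real assume "e > 0"
    then show "\<exists>F. F \<subseteq> E \<and> measure Q E - e < measure Q F \<and>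
        emeasure Q F \<le> liminf (\<lambda>n. emeasure (P n) F)"
      using borel_closed_inner_approx[OF Q.finite_measure_axioms Q(2) E, of e] closed_bound
      by blast
  qed
  then show "setwise_converges P Q"
    by (intro setwise_converges_of_measure_tendsto[OF P Q]
        measure_tendsto_of_lower_bounds[OF P Q])
qed

end
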